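(* Let $\Lambda$ be a nonempty set. Then for every positive algebra automorphism $\Phi$ of $\mathscr B(c_{00}(\Lambda))$ there exist a permutation operator $P$ and a bounded positive diagonal operator $D$ on $c_{00}(\Lambda)$ with bounded inverse such that $$\Phi(T)=PDTD^{-1}P^{-1}$$ for each $T\in\mathscr B(c_{00}(\Lambda))$.
   Context: $c_{00}(\Lambda)$ is the real vector lattice of all finitely supported real functions on $\Lambda$ with pointwise order, equipped with the supremum norm; $e_\lambda$ is the characteristic function of $\{\lambda\}$. $\mathscr B(c_{00}(\Lambda))$ is the algebra of all bounded linear operators on this normed space. A permutation operator is a linear operator $P$ with $Pe_\lambda=e_{\pi(\lambda)}$ for all $\lambda$, for some bijection $\pi\colon\Lambda\to\Lambda$. A diagonal operator is a linear operator $D$ with $De_\lambda=\delta_\lambda e_\lambda$ for real scalars $\delta_\lambda$. An operator $T$ is positive if $Tx\ge0$ for all $x\ge0$. A positive algebra automorphism is a bijective linear multiplicative map $\Phi$ of the algebra onto itself with $\Phi(T)\ge0$ whenever $T\ge0$. *)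

theory Defs
  imports "HOL-Analysis.Analysis"
begin

text \<open>
  The index set is the universe of the type variable \<open>'a\<close>; it is arbitrary and, like every HOL
  type, nonempty.  We do not reuse the finitely supported functions \<open>'a \<Rightarrow>\<^sub>0 real\<close> of
  \<open>Poly_Mapping\<close>: their norm in \<open>Finite_Function_Topology\<close>
  is the sum norm, and their order is a linear, lexicographic one.
\<close>

typedef 'a c00 = "{f :: 'a \<Rightarrow> real. finite {i. f i \<noteq> 0}}"
  morphisms c00_apply Abs_c00
  by (rule exI[of _ "\<lambda>_. 0"]) simp

setup_lifting type_definition_c00

lemma c00_finite_support: "finite {i. c00_apply x i \<noteq> 0}"
  using c00_apply[of x] by simp

lemma c00_eqI: "(\<And>i. c00_apply x i = c00_apply y i) \<Longrightarrow> x = y"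
  by (simp add: c00_apply_inject[symmetric] fun_eq_iff)

lemma finite_range_c00: "finite {i. f i \<noteq> 0} \<Longrightarrow> finite (range f)" for f :: "'a \<Rightarrow> real"
  by (rule finite_subset[of _ "insert 0 (f ` {i. f i \<noteq> 0})"]) auto

lemma finite_support_binop:
  fixes f g :: "'a \<Rightarrow> real"
  assumes "finite {i. f i \<noteq> 0}" "finite {i. g i \<noteq> 0}" "h 0 0 = 0"
  shows "finite {i. h (f i) (g i) \<noteq> (0::real)}"
  by (rule finite_subset[OF _ finite_UnI[OF assms(1,2)]]) (use assms(3) in auto)

lemma bdd_above_c00: "bdd_above (range (\<lambda>i. \<bar>c00_apply x i\<bar>))"
  using finite_range_c00[OF c00_finite_support, of x]
  by (metis finite_imageI bdd_above_finite image_image)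

instantiation c00 :: (type) real_vector
begin

lift_definition zero_c00 :: "'a c00" is "\<lambda>_. 0" by simp

lift_definition plus_c00 :: "'a c00 \<Rightarrow> 'a c00 \<Rightarrow> 'a c00" is "\<lambda>f g i. f i + g i"
  by (rule finite_support_binop) auto

lift_definition minus_c00 :: "'a c00 \<Rightarrow> 'a c00 \<Rightarrow> 'a c00" is "\<lambda>f g i. f i - g i"
  by (rule finite_support_binop) auto

lift_definition uminus_c00 :: "'a c00 \<Rightarrow> 'a c00" is "\<lambda>f i. - f i"
  by simp

lift_definition scaleR_c00 :: "real \<Rightarrow> 'a c00 \<Rightarrow> 'a c00" is "\<lambda>r f i. r * f i"
  by (rule finite_subset) auto

instance
  by standard (transfer; simp add: fun_eq_iff algebra_simps)+

end

instantiation c00 :: (type) real_normed_vector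
begin

definition norm_c00 :: "'a c00 \<Rightarrow> real"
  where "norm_c00 x = (SUP i. \<bar>c00_apply x i\<bar>)"

definition sgn_c00 :: "'a c00 \<Rightarrow> 'a c00"
  where "sgn_c00 x = x /\<^sub>R norm x"

definition dist_c00 :: "'a c00 \<Rightarrow> 'a c00 \<Rightarrow> real"
  where "dist_c00 x y = norm (x - y)"

definition uniformity_c00 :: "('a c00 \<times> 'a c00) filter"
  where "uniformity_c00 = (INF e\<in>{0<..}. principal {(x, y). dist x y < e})"

definition open_c00 :: "'a c00 set \<Rightarrow> bool"
  where "open_c00 U = (\<forall>x\<in>U. \<forall>\<^sub>F (x', y) in uniformity. x' = x \<longrightarrow> y \<in> U)"

lemma abs_c00_le_norm: "\<bar>c00_apply x i\<bar> \<le> norm x"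
  unfolding norm_c00_def by (rule cSUP_upper[OF UNIV_I bdd_above_c00])

lemma norm_c00_le: "(\<And>i. \<bar>c00_apply x i\<bar> \<le> B) \<Longrightarrow> norm x \<le> B"
  unfolding norm_c00_def by (rule cSUP_least) auto

instance
proof
  fix x y :: "'a c00" and r :: real
  have nonneg: "0 \<le> norm z" for z :: "'a c00"
    using abs_c00_le_norm[of z undefined] abs_ge_zero order_trans by blast
  show "norm x = 0 \<longleftrightarrow> x = 0"
  proof
    assume "norm x = 0"
    then have "c00_apply x i = 0" for i
      using abs_c00_le_norm[of x i] by simp
    then show "x = 0"
      by (intro c00_eqI) (simp add: zero_c00.rep_eq)
  next
    assume "x = 0"
    then show "norm x = 0"
      by (simp add: norm_c00_def zero_c00.rep_eq)
  qed
  show "norm (x + y) \<le> norm x + norm y"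
    using abs_c00_le_norm[of x] abs_c00_le_norm[of y]
    by (intro norm_c00_le) (simp add: plus_c00.rep_eq, meson abs_triangle_ineq add_mono order_trans)
  have le: "norm (s *\<^sub>R z) \<le> \<bar>s\<bar> * norm z" for s and z :: "'a c00"
    by (rule norm_c00_le) (simp add: scaleR_c00.rep_eq abs_mult mult_left_mono abs_c00_le_norm)
  show "norm (r *\<^sub>R x) = \<bar>r\<bar> * norm x"
  proof (cases "r = 0")
    case True
    then show ?thesis
      using le[of r x] nonneg[of "r *\<^sub>R x"] by simp
  next
    case False
    then have "\<bar>r\<bar> * norm x \<le> norm (r *\<^sub>R x)"
      using le[of "inverse r" "r *\<^sub>R x"] by (simp add: field_simps)
    with le[of r x] show ?thesis
      by simp
  qed
qed (rule dist_c00_def sgn_c00_def uniformity_c00_def open_c00_def)+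

end

instantiation c00 :: (type) lattice
begin

lift_definition less_eq_c00 :: "'a c00 \<Rightarrow> 'a c00 \<Rightarrow> bool" is "\<lambda>f g. \<forall>i. f i \<le> g i" .

definition less_c00 :: "'a c00 \<Rightarrow> 'a c00 \<Rightarrow> bool"
  where "less_c00 x y \<longleftrightarrow> x \<le> y \<and> \<not> y \<le> x"

lift_definition inf_c00 :: "'a c00 \<Rightarrow> 'a c00 \<Rightarrow> 'a c00" is "\<lambda>f g i. min (f i) (g i)"
  by (rule finite_support_binop) auto

lift_definition sup_c00 :: "'a c00 \<Rightarrow> 'a c00 \<Rightarrow> 'a c00" is "\<lambda>f g i. max (f i) (g i)"
  by (rule finite_support_binop) auto

instance
proof
  fix x y z :: "'a c00"
  show "x < y \<longleftrightarrow> x \<le> y \<and> \<not> y \<le> x"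
    by (rule less_c00_def)
  show "x \<le> x"
    by transfer simp
  show "x \<le> y \<Longrightarrow> y \<le> z \<Longrightarrow> x \<le> z"
    by transfer (meson order_trans)
  show "x \<le> y \<Longrightarrow> y \<le> x \<Longrightarrow> x = y"
    by transfer (auto simp: fun_eq_iff intro: antisym)
  show "inf x y \<le> x" "inf x y \<le> y" "x \<le> sup x y" "y \<le> sup x y"
    by (transfer; simp)+
  show "x \<le> y \<Longrightarrow> x \<le> z \<Longrightarrow> x \<le> inf y z" "y \<le> x \<Longrightarrow> z \<le> x \<Longrightarrow> sup y z \<le> x"
    by (transfer; simp)+
qed

end

instance c00 :: (type) ordered_real_vector
  by standard (transfer; simp add: mult_left_mono mult_right_mono)+

lift_definition c00_unit :: "'a \<Rightarrow> 'a c00" is "\<lambda>l i. if i = l then 1 else 0"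
  by simp

definition permutation_operator :: "('a c00 \<Rightarrow> 'a c00) \<Rightarrow> bool"
  where "permutation_operator P \<longleftrightarrow>
    linear P \<and> (\<exists>\<pi>. bij \<pi> \<and> (\<forall>l. P (c00_unit l) = c00_unit (\<pi> l)))"

definition diagonal_operator :: "('a c00 \<Rightarrow> 'a c00) \<Rightarrow> bool"
  where "diagonal_operator D \<longleftrightarrow>
    linear D \<and> (\<exists>\<delta> :: 'a \<Rightarrow> real. \<forall>l. D (c00_unit l) = \<delta> l *\<^sub>R c00_unit l)"

definition positive_operator :: "('a c00 \<Rightarrow> 'a c00) \<Rightarrow> bool"
  where "positive_operator T \<longleftrightarrow> (\<forall>x\<ge>0. 0 \<le> T x)"

text \<open>
  The algebra of bounded operators is \<open>'a c00 \<Rightarrow>\<^sub>L 'a c00\<close> with composition as multiplication.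
  Positivity is required of \<open>\<Phi>\<close> only, not of its inverse.
\<close>

definition positive_algebra_automorphism ::
    "(('a c00 \<Rightarrow>\<^sub>L 'a c00) \<Rightarrow> ('a c00 \<Rightarrow>\<^sub>L 'a c00)) \<Rightarrow> bool"
  where "positive_algebra_automorphism \<Phi> \<longleftrightarrow>
    linear \<Phi> \<and> bij \<Phi> \<and> (\<forall>S T. \<Phi> (S o\<^sub>L T) = \<Phi> S o\<^sub>L \<Phi> T) \<and>
    (\<forall>T. positive_operator (blinfun_apply T) \<longrightarrow> positive_operator (blinfun_apply (\<Phi> T)))"

end

theory Submission
  imports Defs
begin

text \<open>
  Fix an index \<open>o\<close> and a vector \<open>u \<ge> 0\<close> in the range of the idempotent \<open>\<Phi>(e\<^sub>o \<otimes> e\<^sub>o\<^sup>*)\<close>.  Then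
  \<open>S x = \<Phi>(x \<otimes> e\<^sub>o\<^sup>*) u\<close> is a positive linear bijection with \<open>\<Phi>(T) S = S T\<close>.  Since \<open>\<Phi>\<close> maps the
  diagonal matrix units to the positive operators \<open>S e\<^sub>i \<otimes> (e\<^sub>i\<^sup>* S\<^sup>-\<^sup>1)\<close>, the inverse of \<open>S\<close> is
  positive as well, so \<open>S\<close> permutes the atoms up to positive factors \<open>\<delta>\<^sub>i\<close>.  If \<open>\<delta>\<close> or \<open>1/\<delta>\<close> were
  unbounded, \<open>\<Phi>\<close> would map some partial shift along a rapidly growing sequence to an unbounded
  operator.
\<close>

section \<open>Coordinates, atoms and order of \<open>c00\<close>\<close>

lemma c00_apply_sum: "c00_apply (sum f A) i = (\<Sum>a\<in>A. c00_apply (f a) i)"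
  by (induction A rule: infinite_finite_induct) (simp_all add: zero_c00.rep_eq plus_c00.rep_eq)

lemma c00_expansion: "x = (\<Sum>i | c00_apply x i \<noteq> 0. c00_apply x i *\<^sub>R c00_unit i)"
proof (rule c00_eqI)
  fix j
  have "c00_apply (\<Sum>i | c00_apply x i \<noteq> 0. c00_apply x i *\<^sub>R c00_unit i) j
      = (\<Sum>i | c00_apply x i \<noteq> 0. if j = i then c00_apply x i else 0)"
    unfolding c00_apply_sum by (rule sum.cong) (auto simp: scaleR_c00.rep_eq c00_unit.rep_eq)
  also have "\<dots> = c00_apply x j"
    by (simp add: sum.delta c00_finite_support)
  finally show "c00_apply x j = c00_apply (\<Sum>i | c00_apply x i \<noteq> 0. c00_apply x i *\<^sub>R c00_unit i) j"
    by simp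
qed

lemma linear_c00_eqI:
  assumes "linear f" "linear g" "\<And>i. f (c00_unit i) = g (c00_unit i)"
  shows "f = g"
proof
  fix x :: "'a c00"
  show "f x = g x"
    by (subst (1 2) c00_expansion)
      (simp add: assms linear_sum[OF assms(1)] linear_sum[OF assms(2)]
        linear_scale[OF assms(1)] linear_scale[OF assms(2)])
qed

lemma linear_inv_if_bij:
  assumes "linear f" "bij f"
  shows "linear (inv f)"
proof
  show "inv f (x + y) = inv f x + inv f y" for x y
    using assms by (intro inv_f_eq) (simp_all add: bij_is_inj bij_is_surj surj_f_inv_f linear_add)
  show "inv f (r *\<^sub>R x) = r *\<^sub>R inv f x" for r x
    using assms by (intro inv_f_eq) (simp_all add: bij_is_inj bij_is_surj surj_f_inv_f linear_scale)
qed

lemma c00_unit_nonneg: "0 \<le> c00_unit i"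
  by transfer simp

lemma c00_unit_neq_0: "c00_unit i \<noteq> 0"
  by (metis c00_unit.rep_eq zero_c00.rep_eq zero_neq_one)

lemma norm_c00_unit: "norm (c00_unit i) = 1"
proof (rule antisym)
  show "norm (c00_unit i) \<le> 1"
    by (rule norm_c00_le) (simp add: c00_unit.rep_eq)
  show "1 \<le> norm (c00_unit i)"
    using abs_c00_le_norm[of "c00_unit i" i] by (simp add: c00_unit.rep_eq)
qed

lemma c00_nonneg_iff: "0 \<le> x \<longleftrightarrow> (\<forall>i. 0 \<le> c00_apply x i)"
  by (simp add: less_eq_c00.rep_eq zero_c00.rep_eq)

lemma c00_neq_0_iff: "x \<noteq> 0 \<longleftrightarrow> (\<exists>i. c00_apply x i \<noteq> 0)"
  by (metis c00_eqI zero_c00.rep_eq)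

text \<open>Some coordinate of \<open>x\<close> is positive, and the sign of \<open>c\<close> can be
  read off there. Used to read the signs of the coordinates of \<open>inv S y\<close>.\<close>

lemma c00_nonneg_scaleR_cancel:
  fixes x :: "'a c00"
  assumes "0 \<le> x" "x \<noteq> 0" "0 \<le> c *\<^sub>R x"
  shows "0 \<le> c"
proof -
  obtain i where "c00_apply x i \<noteq> 0"
    using assms(2) by (auto simp: c00_neq_0_iff)
  moreover have "0 \<le> c00_apply x i" "0 \<le> c * c00_apply x i"
    using assms(1,3) by (auto simp: c00_nonneg_iff scaleR_c00.rep_eq)
  ultimately show ?thesis
    by (simp add: zero_le_mult_iff)
qed

lemma positive_operatorD: "positive_operator T \<Longrightarrow> 0 \<le> x \<Longrightarrow> 0 \<le> T x"
  by (simp add: positive_operator_def)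

section \<open>Rank-one operators and the spatial implementation of \<open>\<Phi>\<close>\<close>

definition rank_one :: "'a c00 \<Rightarrow> 'a \<Rightarrow> 'a c00 \<Rightarrow>\<^sub>L 'a c00"
  where "rank_one x k = Blinfun (\<lambda>y. c00_apply y k *\<^sub>R x)"

lemma rank_one_apply: "blinfun_apply (rank_one x k) y = c00_apply y k *\<^sub>R x"
proof -
  have "bounded_linear (\<lambda>y. c00_apply y k *\<^sub>R x)"
  proof (rule bounded_linear_intro)
    show "norm (c00_apply y k *\<^sub>R x) \<le> norm y * norm x" for y
      by (simp add: mult_right_mono abs_c00_le_norm)
  qed (simp_all add: plus_c00.rep_eq scaleR_c00.rep_eq scaleR_left_distrib)
  then show ?thesis
    by (simp add: rank_one_def bounded_linear_Blinfun_apply)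
qed

text \<open>The functional survives left multiplication, so for fixed \<open>k\<close> these
  operators form a left ideal on which \<open>T\<close> acts as it does on vectors. Under
  \<open>\<Phi>\<close> this becomes the intertwining relation for \<open>S\<close>.\<close>

lemma blinfun_compose_rank_one: "T o\<^sub>L rank_one x k = rank_one (blinfun_apply T x) k"
  by (rule blinfun_eqI) (simp add: rank_one_apply blinfun.scaleR_right)

lemma positive_rank_one: "0 \<le> x \<Longrightarrow> positive_operator (blinfun_apply (rank_one x k))"
  by (simp add: positive_operator_def rank_one_apply c00_nonneg_iff scaleR_c00.rep_eq)

lemma positive_algebra_automorphism_spatial:
  fixes \<Phi> :: "('a c00 \<Rightarrow>\<^sub>L 'a c00) \<Rightarrow> ('a c00 \<Rightarrow>\<^sub>L 'a c00)"
  assumes "positive_algebra_automorphism \<Phi>"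
  obtains S where "linear S" "bij S" "positive_operator S" "positive_operator (inv S)"
    "\<And>T. blinfun_apply (\<Phi> T) \<circ> S = S \<circ> blinfun_apply T"
proof -
  have lin: "linear \<Phi>" and bij: "bij \<Phi>"
    and mult: "\<And>S T. \<Phi> (S o\<^sub>L T) = \<Phi> S o\<^sub>L \<Phi> T"
    and pos: "\<And>T. positive_operator (blinfun_apply T) \<Longrightarrow> positive_operator (blinfun_apply (\<Phi> T))"
    using assms by (auto simp: positive_algebra_automorphism_def)
  \<comment> \<open>Any index will do; \<open>undefined\<close> is one because types are
    nonempty.\<close>
  define p :: 'a where "p = undefined"
  define E where "E = rank_one (c00_unit p) p"
  have "blinfun_apply E (c00_unit p) \<noteq> 0"
    by (simp add: E_def rank_one_apply c00_unit.rep_eq c00_unit_neq_0)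
  then have "E \<noteq> 0"
    by auto
  then have "\<Phi> E \<noteq> 0"
    by (metis bij bij_is_inj injD lin linear_0)
  then obtain k where k: "blinfun_apply (\<Phi> E) (c00_unit k) \<noteq> 0"
    using linear_c00_eqI[of "blinfun_apply (\<Phi> E)" "\<lambda>_. 0"]
    by (metis blinfun.bounded_linear_right bounded_linear.linear blinfun_eqI linear_zero zero_blinfun.rep_eq)
  define u where "u = blinfun_apply (\<Phi> E) (c00_unit k)"
  have "positive_operator (blinfun_apply (\<Phi> E))"
    unfolding E_def by (intro pos positive_rank_one c00_unit_nonneg)
  then have u_nonneg: "0 \<le> u"
    unfolding u_def by (rule positive_operatorD[OF _ c00_unit_nonneg])
  \<comment> \<open>Idempotence makes \<open>\<Phi> E\<close> fix \<open>u\<close>, a vector of its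
    range; hence \<open>S\<close> sends the atom at \<open>p\<close> to \<open>u\<close>.\<close>
  have "E o\<^sub>L E = E"
    by (simp add: E_def blinfun_compose_rank_one rank_one_apply c00_unit.rep_eq)
  then have Eu: "blinfun_apply (\<Phi> E) u = u"
    by (metis mult u_def blinfun_apply_blinfun_compose)
  define S where "S x = blinfun_apply (\<Phi> (rank_one x p)) u" for x
  have S: "linear S"
  proof
    have "rank_one (x + y) p = rank_one x p + rank_one y p" for x y
      by (rule blinfun_eqI) (simp add: rank_one_apply blinfun.add_left scaleR_right_distrib)
    then show "S (x + y) = S x + S y" for x y
      by (simp add: S_def linear_add[OF lin] blinfun.add_left)
    have "rank_one (r *\<^sub>R x) p = r *\<^sub>R rank_one x p" for r x
      by (rule blinfun_eqI) (simp add: rank_one_apply blinfun.scaleR_left mult.commute)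
    then show "S (r *\<^sub>R x) = r *\<^sub>R S x" for r x
      by (simp add: S_def linear_scale[OF lin] blinfun.scaleR_left)
  qed
  have intertwine: "blinfun_apply (\<Phi> T) (S x) = S (blinfun_apply T x)" for T x
    by (simp add: S_def flip: blinfun_compose_rank_one mult blinfun_apply_blinfun_compose)
  have S_unit: "S (c00_unit p) = u"
    using Eu by (simp add: S_def E_def)
  have u_neq_0: "u \<noteq> 0"
    using k by (simp add: u_def)
  have inj: "inj S"
  proof (subst linear_injective_0[OF S], intro allI impI, rule ccontr)
    fix x assume "S x = 0" "x \<noteq> 0"
    then obtain j where "c00_apply x j \<noteq> 0"
      by (auto simp: c00_neq_0_iff)
    \<comment> \<open>A rank-one operator moves any nonzero \<open>x\<close> to the atom at
      \<open>p\<close>; by intertwining, \<open>S x = 0\<close> would force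
      \<open>u = 0\<close>.\<close>
    then have "blinfun_apply (rank_one ((1 / c00_apply x j) *\<^sub>R c00_unit p) j) x = c00_unit p"
      by (simp add: rank_one_apply)
    then have "u = 0"
      using intertwine[of "rank_one ((1 / c00_apply x j) *\<^sub>R c00_unit p) j" x] \<open>S x = 0\<close> S_unit
      by (simp add: blinfun.zero_right)
    with u_neq_0 show False ..
  qed
  have surj: "surj S"
  proof -
    \<comment> \<open>A rank-one operator moves \<open>u\<close> to any prescribed \<open>y\<close>.
      Its preimage under \<open>\<Phi>\<close>, applied to the atom at \<open>p\<close>, is the
      vector that \<open>S\<close> sends to \<open>y\<close>.\<close>
    obtain j where j: "c00_apply u j \<noteq> 0"
      using u_neq_0 by (auto simp: c00_neq_0_iff)
    have "\<Phi> (inv \<Phi> R) = R" for R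
      using bij by (simp add: bij_is_surj surj_f_inv_f)
    then have "blinfun_apply (\<Phi> (inv \<Phi> (rank_one ((1 / c00_apply u j) *\<^sub>R y) j))) u = y" for y
      using j by (simp add: rank_one_apply)
    then have "S (blinfun_apply (inv \<Phi> (rank_one ((1 / c00_apply u j) *\<^sub>R y) j)) (c00_unit p)) = y"
      for y
      by (simp add: S_unit flip: intertwine)
    then show ?thesis
      by (rule surjI)
  qed
  have pos_S: "positive_operator S"
    unfolding positive_operator_def
  proof (intro allI impI)
    show "0 \<le> S x" if "0 \<le> x" for x
      unfolding S_def by (rule positive_operatorD[OF pos[OF positive_rank_one[OF that]] u_nonneg])
  qed
  have "positive_operator (inv S)"
    unfolding positive_operator_def
  proof (intro allI impI)
    fix y :: "'a c00" assume y: "0 \<le> y"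
    show "0 \<le> inv S y"
      unfolding c00_nonneg_iff
    proof
      fix i
      \<comment> \<open>The diagonal matrix unit at \<open>i\<close> isolates the
        \<open>i\<close>-th coordinate of \<open>inv S y\<close> as the coefficient of the positive
        vector \<open>S (c00_unit i)\<close>.\<close>
      have "blinfun_apply (\<Phi> (rank_one (c00_unit i) i)) y = c00_apply (inv S y) i *\<^sub>R S (c00_unit i)"
        using intertwine[of "rank_one (c00_unit i) i" "inv S y"] surj
        by (simp add: surj_f_inv_f rank_one_apply linear_scale[OF S])
      moreover have "0 \<le> blinfun_apply (\<Phi> (rank_one (c00_unit i) i)) y"
        by (rule positive_operatorD[OF pos[OF positive_rank_one[OF c00_unit_nonneg]] y])
      moreover have "0 \<le> S (c00_unit i)"
        by (rule positive_operatorD[OF pos_S c00_unit_nonneg])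
      moreover have "S (c00_unit i) \<noteq> 0"
        using inj S c00_unit_neq_0 by (metis injD linear_0)
      ultimately show "0 \<le> c00_apply (inv S y) i"
        by (metis c00_nonneg_scaleR_cancel)
    qed
  qed
  with S inj surj pos_S intertwine show ?thesis
    by (intro that[of S]) (auto simp: bij_def)
qed

section \<open>Order isomorphisms of \<open>c00\<close> as weighted permutations of atoms\<close>

text \<open>
  If \<open>e\<^sub>j\<close> occurs in \<open>S e\<^sub>i\<close>, then \<open>S\<^sup>-\<^sup>1 e\<^sub>j\<close> is dominated by a multiple of the atom \<open>e\<^sub>i\<close>.
\<close>
lemma order_isomorphism_c00_unit:
  fixes S :: "'a c00 \<Rightarrow> 'a c00"
  assumes S: "linear S" "bij S" and pos: "positive_operator S" "positive_operator (inv S)"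
  shows "\<exists>j c. 0 < c \<and> S (c00_unit i) = c *\<^sub>R c00_unit j"
proof -
  have lin': "linear (inv S)"
    using S by (rule linear_inv_if_bij)
  have "S (c00_unit i) \<noteq> 0"
    using S c00_unit_neq_0 by (metis bij_is_inj injD linear_0)
  then obtain j where j: "c00_apply (S (c00_unit i)) j \<noteq> 0"
    by (auto simp: c00_neq_0_iff)
  define c where "c = c00_apply (S (c00_unit i)) j"
  have S_nonneg: "0 \<le> S (c00_unit i)"
    by (rule positive_operatorD[OF pos(1) c00_unit_nonneg])
  then have c: "0 < c"
    using j by (simp add: c_def c00_nonneg_iff order_less_le)
  define z where "z = inv S (c00_unit j)"
  have z_nonneg: "0 \<le> z"
    unfolding z_def by (rule positive_operatorD[OF pos(2) c00_unit_nonneg])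
  have "0 \<le> S (c00_unit i) - c *\<^sub>R c00_unit j"
    using S_nonneg
    by (auto simp: c00_nonneg_iff c_def minus_c00.rep_eq scaleR_c00.rep_eq c00_unit.rep_eq)
  then have "0 \<le> inv S (S (c00_unit i) - c *\<^sub>R c00_unit j)"
    by (rule positive_operatorD[OF pos(2)])
  then have dom: "0 \<le> c00_unit i - c *\<^sub>R z"
    using S by (simp add: z_def linear_diff[OF lin'] linear_scale[OF lin'] bij_is_inj)
  have "c00_apply z l = 0" if "l \<noteq> i" for l
  proof -
    have "c * c00_apply z l \<le> 0" "0 \<le> c00_apply z l"
      using dom z_nonneg that
      by (auto simp: c00_nonneg_iff minus_c00.rep_eq scaleR_c00.rep_eq c00_unit.rep_eq
          dest!: spec[of _ l])
    with c show ?thesis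
      by (simp add: mult_le_0_iff)
  qed
  then have z: "z = c00_apply z i *\<^sub>R c00_unit i"
    by (intro c00_eqI) (auto simp: scaleR_c00.rep_eq c00_unit.rep_eq)
  have Sz: "c00_unit j = c00_apply z i *\<^sub>R S (c00_unit i)"
  proof -
    have "c00_unit j = S z"
      using S by (simp add: z_def bij_is_surj surj_f_inv_f)
    also have "\<dots> = c00_apply z i *\<^sub>R S (c00_unit i)"
      using arg_cong[OF z, of S] by (simp add: linear_scale[OF S(1)])
    finally show ?thesis .
  qed
  then have nz: "c00_apply z i \<noteq> 0"
    using c00_unit_neq_0[of j] by auto
  then have "S (c00_unit i) = (1 / c00_apply z i) *\<^sub>R c00_unit j"
    by (subst Sz) simp
  moreover have "0 < 1 / c00_apply z i"
    using nz z_nonneg by (simp add: c00_nonneg_iff order_less_le)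
  ultimately show ?thesis
    by blast
qed

lemma c00_unit_scaleR_eqD:
  assumes "a *\<^sub>R c00_unit i = b *\<^sub>R c00_unit j" "a \<noteq> 0"
  shows "i = j"
  using arg_cong[OF assms(1), of "\<lambda>x. c00_apply x i"] assms(2)
  by (auto simp: scaleR_c00.rep_eq c00_unit.rep_eq split: if_splits)

text \<open>Injectivity of \<open>\<pi>\<close> comes from that of \<open>S\<close>; surjectivity
  comes from applying the result on atoms to \<open>inv S\<close>, whose hypotheses are
  symmetric.\<close>

lemma order_isomorphism_c00:
  fixes S :: "'a c00 \<Rightarrow> 'a c00"
  assumes S: "linear S" "bij S" and pos: "positive_operator S" "positive_operator (inv S)"
  obtains \<pi> \<delta> where "bij \<pi>" "\<And>i. 0 < \<delta> i" "\<And>i. S (c00_unit i) = \<delta> i *\<^sub>R c00_unit (\<pi> i)"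
proof -
  obtain \<pi> \<delta> where \<delta>: "\<And>i. 0 < \<delta> i" and unit: "\<And>i. S (c00_unit i) = \<delta> i *\<^sub>R c00_unit (\<pi> i)"
    using order_isomorphism_c00_unit[OF assms] by metis
  have lin': "linear (inv S)"
    using S by (rule linear_inv_if_bij)
  have "inj \<pi>"
  proof (rule injI)
    fix i j assume "\<pi> i = \<pi> j"
    \<comment> \<open>Cross-multiplying by the weights makes the two images coincide.\<close>
    then have "S (\<delta> j *\<^sub>R c00_unit i) = S (\<delta> i *\<^sub>R c00_unit j)"
      by (simp add: linear_scale[OF S(1)] unit)
    then have "\<delta> j *\<^sub>R c00_unit i = \<delta> i *\<^sub>R c00_unit j"
      using S(2) by (meson bij_is_inj injD)
    then show "i = j"
      using \<delta>[of j] by (auto intro: c00_unit_scaleR_eqD)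
  qed
  moreover have "surj \<pi>"
  proof
    show "UNIV \<subseteq> range \<pi>"
    proof
      fix j
      have "bij (inv S)" "inv (inv S) = S"
        using S(2) by (simp_all add: bij_imp_bij_inv inv_inv_eq)
      then obtain i c where "inv S (c00_unit j) = c *\<^sub>R c00_unit i"
        using order_isomorphism_c00_unit[of "inv S" j] lin' pos by auto
      then have "S (inv S (c00_unit j)) = (c * \<delta> i) *\<^sub>R c00_unit (\<pi> i)"
        by (simp add: linear_scale[OF S(1)] unit)
      then have "1 *\<^sub>R c00_unit j = (c * \<delta> i) *\<^sub>R c00_unit (\<pi> i)"
        using S(2) by (simp add: bij_is_surj surj_f_inv_f)
      then show "j \<in> range \<pi>"
        using c00_unit_scaleR_eqD[of 1 j "c * \<delta> i" "\<pi> i"] by simp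
    qed
  qed simp
  ultimately show ?thesis
    using \<delta> unit by (intro that bijI)
qed

section \<open>Weighted composition operators: the common form of partial shifts, \<open>D\<close>
  and \<open>P\<close>\<close>

text \<open>
  The junk value of \<open>Abs_c00\<close> is avoided only if \<open>h\<close> is injective on the support of \<open>w\<close>.
\<close>
definition weighted_comp :: "('a \<Rightarrow> real) \<Rightarrow> ('a \<Rightarrow> 'a) \<Rightarrow> 'a c00 \<Rightarrow> 'a c00"
  where "weighted_comp w h x = Abs_c00 (\<lambda>i. w i * c00_apply x (h i))"

lemma weighted_comp_apply:
  assumes "inj_on h {i. w i \<noteq> 0}"
  shows "c00_apply (weighted_comp w h x) i = w i * c00_apply x (h i)"
proof -
  have "finite (h -` {j. c00_apply x j \<noteq> 0} \<inter> {i. w i \<noteq> 0})"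
    by (rule finite_vimage_IntI[OF c00_finite_support assms])
  then have "finite {i. w i * c00_apply x (h i) \<noteq> 0}"
    by (rule rev_finite_subset) auto
  then show ?thesis
    by (simp add: weighted_comp_def Abs_c00_inverse)
qed

lemma linear_weighted_comp:
  assumes "inj_on h {i. w i \<noteq> 0}"
  shows "linear (weighted_comp w h)"
  by (rule linearI; rule c00_eqI)
    (simp_all add: weighted_comp_apply[OF assms] plus_c00.rep_eq scaleR_c00.rep_eq distrib_left)

lemma bounded_linear_weighted_comp:
  assumes "inj_on h {i. w i \<noteq> 0}" "\<And>i. \<bar>w i\<bar> \<le> C"
  shows "bounded_linear (weighted_comp w h)"
proof -
  have "norm (weighted_comp w h x) \<le> norm x * C" for x
  proof (rule norm_c00_le)
    fix i
    have "\<bar>w i\<bar> * \<bar>c00_apply x (h i)\<bar> \<le> C * norm x"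
      using assms(2)[of i] by (intro mult_mono abs_c00_le_norm) auto
    then show "\<bar>c00_apply (weighted_comp w h x) i\<bar> \<le> norm x * C"
      by (simp add: weighted_comp_apply[OF assms(1)] abs_mult mult.commute)
  qed
  with linear_weighted_comp[OF assms(1)] show ?thesis
    unfolding bounded_linear_def bounded_linear_axioms_def by blast
qed

text \<open>Injectivity on the support of \<open>w\<close> leaves \<open>i\<close> as the only
  supported index with image \<open>h i\<close>, so no other coordinate survives.\<close>

lemma weighted_comp_unit:
  assumes "inj_on h {i. w i \<noteq> 0}" "w i \<noteq> 0"
  shows "weighted_comp w h (c00_unit (h i)) = w i *\<^sub>R c00_unit i"
proof (rule c00_eqI)
  fix j
  have "w j = 0" if "h j = h i" "j \<noteq> i"
    using assms that by (metis (mono_tags, lifting) inj_onD mem_Collect_eq)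
  then show "c00_apply (weighted_comp w h (c00_unit (h i))) j = c00_apply (w i *\<^sub>R c00_unit i) j"
    by (auto simp: weighted_comp_apply[OF assms(1)] scaleR_c00.rep_eq c00_unit.rep_eq)
qed

section \<open>Boundedness from ratios along partial injections\<close>

text \<open>
  Test the hypothesis on the backward shift along a sequence on which \<open>f\<close> grows superexponentially.
\<close>
lemma bounded_if_bounded_ratios:
  fixes f :: "'a \<Rightarrow> real"
  assumes f: "\<And>i. 0 < f i"
    and ratio: "\<And>h A. inj_on h A \<Longrightarrow> \<exists>C. \<forall>i\<in>A. f i \<le> C * f (h i)"
  shows "\<exists>B. \<forall>i. f i \<le> B"
proof (rule ccontr)
  assume unbounded: "\<not> ?thesis"
  obtain s where s: "\<And>n. real (n + 1) * f (s n) < f (s (Suc n))"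
    using dependent_nat_choice[of "\<lambda>_ _. True" "\<lambda>n x y. real (n + 1) * f x < f y"] unbounded
    by (auto simp: not_le)
  have "f (s n) < f (s (Suc n))" for n
    using s[of n] mult_right_mono[OF _ less_imp_le[OF f], of 1 "real (n + 1)" "s n"] by linarith
  then have "inj (\<lambda>n. f (s n))"
    by (intro strict_mono_imp_inj_on) (simp add: strict_mono_Suc_iff)
  then have inj: "inj s"
    by (auto simp: inj_def)
  \<comment> \<open>The backward shift along \<open>s\<close>. It fixes \<open>s 0\<close> because
    \<open>0 - 1 = 0\<close> on naturals, so \<open>s 0\<close> and \<open>s 1\<close> have the same
    image; injectivity is therefore claimed only on the tail starting at \<open>s 1\<close>.\<close>
  define h where "h i = s (inv s i - 1)" for i
  have h: "h (s (Suc n)) = s n" for n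
    using inj by (simp add: h_def)
  have "inj_on h (range (\<lambda>n. s (Suc n)))"
    using inj by (auto simp: inj_on_def h)
  then obtain C where C: "\<And>n. f (s (Suc n)) \<le> C * f (s n)"
    using ratio h by (metis rangeI)
  have "real (n + 1) < C" for n
    using order_less_le_trans[OF s C, of n] f by (simp only: mult_less_cancel_right_pos)
  then show False
    by (metis reals_Archimedean2 less_asym of_nat_1 of_nat_add less_add_one
        order_less_trans of_nat_less_iff)
qed

section \<open>Boundedness of the weights and factorization of \<open>S\<close>\<close>

theorem corollary6p6:
  fixes \<Phi> :: "('a c00 \<Rightarrow>\<^sub>L 'a c00) \<Rightarrow> ('a c00 \<Rightarrow>\<^sub>L 'a c00)"
  assumes "positive_algebra_automorphism \<Phi>"
  shows "\<exists>(P :: 'a c00 \<Rightarrow> 'a c00) (D :: 'a c00 \<Rightarrow> 'a c00).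
    permutation_operator P \<and>
    diagonal_operator D \<and> bounded_linear D \<and> positive_operator D \<and>
    bij D \<and> bounded_linear (inv D) \<and>
    (\<forall>T :: 'a c00 \<Rightarrow>\<^sub>L 'a c00.
      blinfun_apply (\<Phi> T) = P \<circ> D \<circ> blinfun_apply T \<circ> inv D \<circ> inv P)"
proof -
  obtain S where S: "linear S" "bij S" "positive_operator S" "positive_operator (inv S)"
    and intertwine: "\<And>T. blinfun_apply (\<Phi> T) \<circ> S = S \<circ> blinfun_apply T"
    using positive_algebra_automorphism_spatial[OF assms] by blast
  obtain \<pi> \<delta> where \<pi>: "bij \<pi>" and \<delta>: "\<And>i. 0 < \<delta> i"
    and S_unit: "\<And>i. S (c00_unit i) = \<delta> i *\<^sub>R c00_unit (\<pi> i)"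
    using order_isomorphism_c00[OF S] by blast
  have ratio: "\<exists>C. \<forall>i\<in>A. \<delta> i \<le> C * \<delta> (h i)" if "inj_on h A" for h A
  proof -
    \<comment> \<open>\<open>T\<close> sends the atom at \<open>h i\<close> to the atom at
      \<open>i\<close> for \<open>i\<close> in \<open>A\<close>. Conjugation by \<open>S\<close>
      rescales this entry by \<open>\<delta> i / \<delta> (h i)\<close>, so the norm of
      \<open>\<Phi> T\<close> bounds all these ratios.\<close>
    define T where "T = Blinfun (weighted_comp (indicator A) h)"
    have inj: "inj_on h {i. indicator A i \<noteq> (0::real)}"
      using that by (simp add: indicator_def)
    have "bounded_linear (weighted_comp (indicator A) h)"
      by (rule bounded_linear_weighted_comp[OF inj, of 1]) (simp add: indicator_def)
    then have T: "blinfun_apply T = weighted_comp (indicator A) h"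
      by (simp add: T_def bounded_linear_Blinfun_apply)
    have "\<delta> i \<le> norm (\<Phi> T) * \<delta> (h i)" if "i \<in> A" for i
    proof -
      have "blinfun_apply T (c00_unit (h i)) = c00_unit i"
        using that weighted_comp_unit[OF inj, of i] by (simp add: T)
      then have "blinfun_apply (\<Phi> T) (\<delta> (h i) *\<^sub>R c00_unit (\<pi> (h i))) = \<delta> i *\<^sub>R c00_unit (\<pi> i)"
        using fun_cong[OF intertwine[of T], of "c00_unit (h i)"] by (simp add: S_unit)
      then show ?thesis
        using norm_blinfun[of "\<Phi> T" "\<delta> (h i) *\<^sub>R c00_unit (\<pi> (h i))"] \<delta>[of i] \<delta>[of "h i"]
        by (simp add: norm_c00_unit)
    qed
    then show ?thesis
      by blast
  qed
  obtain B where B: "\<And>i. \<delta> i \<le> B"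
    using bounded_if_bounded_ratios[of \<delta>] \<delta> ratio by blast
  have "\<exists>C. \<forall>i\<in>A. inverse (\<delta> i) \<le> C * inverse (\<delta> (h i))" if "inj_on h A" for h A
  proof -
    obtain C where C: "\<And>j. j \<in> h ` A \<Longrightarrow> \<delta> j \<le> C * \<delta> (inv_into A h j)"
      using ratio[OF inj_on_inv_into[OF order_refl, of A h]] by blast
    have "inverse (\<delta> i) \<le> C * inverse (\<delta> (h i))" if "i \<in> A" for i
      using C[of "h i"] that \<open>inj_on h A\<close> \<delta>[of i] \<delta>[of "h i"] by (simp add: field_simps)
    then show ?thesis
      by blast
  qed
  then obtain B' where B': "\<And>i. inverse (\<delta> i) \<le> B'"
    using bounded_if_bounded_ratios[of "\<lambda>i. inverse (\<delta> i)"] \<delta> by auto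
  define D where "D = weighted_comp \<delta> id"
  define D' where "D' = weighted_comp (\<lambda>i. inverse (\<delta> i)) id"
  \<comment> \<open>Composition pulls coordinates back, so \<open>inv \<pi>\<close> is what moves
    atoms forward along \<open>\<pi>\<close>.\<close>
  define P where "P = weighted_comp (\<lambda>_. 1) (inv \<pi>)"
  have \<delta>_neq_0: "\<delta> i \<noteq> 0" for i
    using \<delta>[of i] by simp
  have D_apply: "c00_apply (D x) i = \<delta> i * c00_apply x i" for x i
    by (simp add: D_def weighted_comp_apply)
  have D'_apply: "c00_apply (D' x) i = inverse (\<delta> i) * c00_apply x i" for x i
    by (simp add: D'_def weighted_comp_apply)
  have D: "bounded_linear D"
    unfolding D_def using B \<delta> by (intro bounded_linear_weighted_comp[of _ _ B]) (auto simp: less_imp_le)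
  have D': "bounded_linear D'"
    unfolding D'_def using B' \<delta>
    by (intro bounded_linear_weighted_comp[of _ _ B']) (auto simp: less_imp_le)
  have comp: "D \<circ> D' = id" "D' \<circ> D = id"
    by (auto intro!: c00_eqI simp: fun_eq_iff D_apply D'_apply \<delta>_neq_0)
  have bij_D: "bij D" and inv_D: "inv D = D'"
    using comp by (auto intro: o_bij inv_unique_comp)
  have D_unit: "D (c00_unit i) = \<delta> i *\<^sub>R c00_unit i" for i
    using weighted_comp_unit[of id \<delta> i] by (simp add: D_def \<delta>_neq_0)
  have inj_inv: "inj_on (inv \<pi>) {i. (1::real) \<noteq> 0}"
    using \<pi> by (simp add: bij_imp_bij_inv bij_is_inj)
  have P: "linear P"
    unfolding P_def by (rule linear_weighted_comp[OF inj_inv])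
  have P_unit: "P (c00_unit i) = c00_unit (\<pi> i)" for i
    using weighted_comp_unit[OF inj_inv, of "\<pi> i"] \<pi> by (simp add: P_def bij_is_inj)
  have S_eq: "S = P \<circ> D"
    using D by (intro linear_c00_eqI linear_compose S P)
      (auto simp: bounded_linear.linear D_unit P_unit S_unit linear_scale[OF P])
  \<comment> \<open>Bijectivity of \<open>P\<close> is inherited from \<open>S\<close> and
    \<open>inv D\<close>.\<close>
  have "P = S \<circ> D'"
    using comp by (simp add: S_eq comp_assoc)
  then have bij_P: "bij P"
    using bij_comp[OF bij_imp_bij_inv[OF bij_D] S(2)] by (simp add: inv_D)
  have "blinfun_apply (\<Phi> T) = P \<circ> D \<circ> blinfun_apply T \<circ> inv D \<circ> inv P" for T
  proof -
    have "blinfun_apply (\<Phi> T) = blinfun_apply (\<Phi> T) \<circ> S \<circ> inv S"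
      using S(2) by (simp add: comp_assoc surj_iff[THEN iffD1] bij_is_surj)
    also have "\<dots> = S \<circ> blinfun_apply T \<circ> inv S"
      by (simp only: intertwine)
    finally show ?thesis
      by (simp add: S_eq o_inv_distrib bij_P bij_D comp_assoc)
  qed
  moreover have "permutation_operator P"
    using P P_unit \<pi> by (auto simp: permutation_operator_def)
  moreover have "diagonal_operator D"
    using D D_unit by (auto simp: diagonal_operator_def bounded_linear.linear)
  moreover have "positive_operator D"
    using \<delta> by (simp add: positive_operator_def c00_nonneg_iff D_apply less_imp_le)
  ultimately show ?thesis
    using D D' bij_D inv_D by auto
qed

end
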